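(* Let $\mathcal{R}$ be a commutative ring with unity such that $\frac12\in\mathcal{R}$, let $a,b\in\mathcal{R}$ be units, and let $\mathcal{H}^{a,b}$ be the generalized quaternion algebra over $\mathcal{R}$, regarded as a superalgebra. Then every local superderivation of degree $1$ on $\mathcal{H}^{a,b}$ is a superderivation of degree $1$ of $\mathcal{H}^{a,b}$.
   Context: The generalized quaternion algebra $\mathcal{H}^{a,b}$ is the free $\mathcal{R}$-module with basis $\{1,i,j,k\}$ with the associative unital ($\mathcal{R}$-bilinear) multiplication determined by $i^2=-a$, $j^2=-b$, $k^2=-ab$, $ij=-ji=k$, $jk=-kj=bi$, $ki=-ik=aj$. It is a superalgebra ($\mathbb{Z}_2$-graded algebra) with even part $\mathcal{A}_0=\mathcal{R}\oplus\mathcal{R}i$ and odd part $\mathcal{A}_1=\mathcal{R}j\oplus\mathcal{R}k$; for $x\in\mathcal{A}_\alpha$ write $|x|=\alpha$. For $\alpha\in\{0,1\}$, a superderivation of degree $\alpha$ of $\mathcal{A}=\mathcal{H}^{a,b}$ is an $\mathcal{R}$-linear map $D:\mathcal{A}\to\mathcal{A}$ with $D(\mathcal{A}_\beta)\subseteq\mathcal{A}_{\alpha+\beta}$ (indices mod 2) and $D(xy)=D(x)y+(-1)^{\alpha|x|}xD(y)$ for all $x,y\in\mathcal{A}_0\cup\mathcal{A}_1$. A local superderivation of degree $\gamma\in\mathbb{Z}_2$ is an $\mathcal{R}$-linear map $\Delta:\mathcal{H}^{a,b}\to\mathcal{H}^{a,b}$ such that for every $x\in\mathcal{H}^{a,b}$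 there exists a superderivation $d_x$ of degree $\gamma$ of $\mathcal{H}^{a,b}$ (depending on $x$) with $\Delta(x)=d_x(x)$. *)

theory Defs
  imports Complex_Main "HOL-Library.Z2"
begin

text \<open>
  Elements of the generalized quaternion algebra are written in coordinates with respect to
  the basis 1, i, j, k. The underlying module does not depend on the parameters a and b; only
  the multiplication \<open>qmult a b\<close> does.
\<close>

datatype 'r quat = Quat (qre: 'r) (qi: 'r) (qj: 'r) (qk: 'r)

instantiation quat :: (ab_group_add) ab_group_add
begin

definition zero_quat :: "'a quat" where
  "zero_quat = Quat 0 0 0 0"

definition plus_quat :: "'a quat \<Rightarrow> 'a quat \<Rightarrow> 'a quat" where
  "plus_quat x y = Quat (qre x + qre y) (qi x + qi y) (qj x + qj y) (qk x + qk y)"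

definition uminus_quat :: "'a quat \<Rightarrow> 'a quat" where
  "uminus_quat x = Quat (- qre x) (- qi x) (- qj x) (- qk x)"

definition minus_quat :: "'a quat \<Rightarrow> 'a quat \<Rightarrow> 'a quat" where
  "minus_quat x y = Quat (qre x - qre y) (qi x - qi y) (qj x - qj y) (qk x - qk y)"

instance
  by standard
    (simp_all add: zero_quat_def plus_quat_def uminus_quat_def minus_quat_def algebra_simps)

end

definition qscale :: "'r::comm_ring_1 \<Rightarrow> 'r quat \<Rightarrow> 'r quat" where
  "qscale r x = Quat (r * qre x) (r * qi x) (r * qj x) (r * qk x)"

definition quat_1 :: "'r::comm_ring_1 quat" where "quat_1 = Quat 1 0 0 0"
definition quat_i :: "'r::comm_ring_1 quat" where "quat_i = Quat 0 1 0 0"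
definition quat_j :: "'r::comm_ring_1 quat" where "quat_j = Quat 0 0 1 0"
definition quat_k :: "'r::comm_ring_1 quat" where "quat_k = Quat 0 0 0 1"

text \<open>
  The bilinear extension of the multiplication table of the basis elements, collected by
  coordinates. The lemmas below recover the table, bilinearity, the unit and associativity.
\<close>

definition qmult :: "'r::comm_ring_1 \<Rightarrow> 'r \<Rightarrow> 'r quat \<Rightarrow> 'r quat \<Rightarrow> 'r quat" where
  "qmult a b x y = Quat
     (qre x * qre y - a * (qi x * qi y) - b * (qj x * qj y) - a * b * (qk x * qk y))
     (qre x * qi y + qi x * qre y + b * (qj x * qk y - qk x * qj y))
     (qre x * qj y + qj x * qre y + a * (qk x * qi y - qi x * qk y))
     (qre x * qk y + qk x * qre y + (qi x * qj y - qj x * qi y))"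

lemmas quat_defs = zero_quat_def plus_quat_def uminus_quat_def minus_quat_def
  qscale_def quat_1_def quat_i_def quat_j_def quat_k_def qmult_def

lemma module_qscale: "module (qscale :: 'r::comm_ring_1 \<Rightarrow> 'r quat \<Rightarrow> 'r quat)"
  by standard (simp_all add: quat_defs algebra_simps)

lemma quat_basis_expansion:
  "Quat p q r s = qscale p quat_1 + qscale q quat_i + qscale r quat_j + qscale s quat_k"
  by (simp add: quat_defs)

lemma qmult_table:
  "qmult a b quat_i quat_i = qscale (- a) quat_1"
  "qmult a b quat_j quat_j = qscale (- b) quat_1"
  "qmult a b quat_k quat_k = qscale (- (a * b)) quat_1"
  "qmult a b quat_i quat_j = quat_k" "qmult a b quat_j quat_i = - quat_k"
  "qmult a b quat_j quat_k = qscale b quat_i" "qmult a b quat_k quat_j = - qscale b quat_i"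
  "qmult a b quat_k quat_i = qscale a quat_j" "qmult a b quat_i quat_k = - qscale a quat_j"
  by (simp_all add: quat_defs)

lemma qmult_unit: "qmult a b quat_1 x = x" "qmult a b x quat_1 = x"
  by (simp_all add: quat_defs)

lemma qmult_assoc: "qmult a b (qmult a b x y) z = qmult a b x (qmult a b y z)"
  by (simp add: quat_defs algebra_simps)

lemma qmult_bilinear:
  "qmult a b (x + y) z = qmult a b x z + qmult a b y z"
  "qmult a b x (y + z) = qmult a b x y + qmult a b x z"
  "qmult a b (qscale r x) y = qscale r (qmult a b x y)"
  "qmult a b x (qscale r y) = qscale r (qmult a b x y)"
  by (simp_all add: quat_defs algebra_simps)

text \<open>
  Degrees are elements of the two-element field \<^typ>\<open>bit\<close>, so that sums of degrees are
  taken mod 2.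
\<close>

definition qpart :: "bit \<Rightarrow> 'r::comm_ring_1 quat set" where
  "qpart \<alpha> = (if \<alpha> = 0 then {qscale p quat_1 + qscale q quat_i | p q. True}
                       else {qscale r quat_j + qscale s quat_k | r s. True})"

lemma qmult_graded:
  assumes "x \<in> qpart \<alpha>" and "y \<in> qpart \<beta>"
  shows "qmult a b x y \<in> qpart (\<alpha> + \<beta>)"
  using assms by (cases \<alpha>; cases \<beta>) (auto simp: qpart_def quat_defs)

text \<open>
  The sign is governed by any degree \<open>\<xi>\<close> with \<open>x \<in> qpart \<xi>\<close>. This is unambiguous
  except for \<open>x = 0\<close>, where the identity is trivial for both signs.
\<close>

definition superderivation ::
    "'r::comm_ring_1 \<Rightarrow> 'r \<Rightarrow> bit \<Rightarrow> ('r quat \<Rightarrow> 'r quat) \<Rightarrow> bool" where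
  "superderivation a b \<alpha> D \<longleftrightarrow>
     module_hom qscale qscale D \<and>
     (\<forall>\<beta>. D ` qpart \<beta> \<subseteq> qpart (\<alpha> + \<beta>)) \<and>
     (\<forall>\<xi>. \<forall>x\<in>qpart \<xi>. \<forall>y\<in>qpart 0 \<union> qpart 1.
        D (qmult a b x y) =
          qmult a b (D x) y + qscale ((- 1) ^ of_bit (\<alpha> * \<xi>)) (qmult a b x (D y)))"

definition local_superderivation ::
    "'r::comm_ring_1 \<Rightarrow> 'r \<Rightarrow> bit \<Rightarrow> ('r quat \<Rightarrow> 'r quat) \<Rightarrow> bool" where
  "local_superderivation a b \<gamma> \<Delta> \<longleftrightarrow>
     module_hom qscale qscale \<Delta> \<and>
     (\<forall>x. \<exists>d. superderivation a b \<gamma> d \<and> \<Delta> x = d x)"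

end

theory Submission
  imports Defs
begin

text \<open>
  Evaluating the superderivation identity on \<open>i\<^sup>2\<close>, \<open>j\<^sup>2\<close>, \<open>k\<^sup>2\<close> and \<open>i j\<close> shows that a
  superderivation of degree 1 is determined by the two coordinates of its value
  \<open>r j + s k\<close> at \<open>i\<close>: it sends \<open>j\<close> to \<open>b s\<close> and \<open>k\<close> to \<open>- b r\<close>, and conversely every such
  map is a superderivation. A linear map that agrees pointwise with maps of this form takes
  values of this shape at \<open>i\<close>, \<open>j\<close>, \<open>k\<close> with a priori unrelated parameters; the values at
  \<open>i + j\<close> and \<open>i + k\<close> force the parameters to coincide.
\<close>

text \<open>When 2 and \<open>a\<close> are invertible, this is the inner superderivation x
  \<mapsto> u x - (-1)^|x| x u with u = -(s/2) j + (r/(2a)) k.\<close>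

definition odd_superder :: "'r::comm_ring_1 \<Rightarrow> 'r \<Rightarrow> 'r \<Rightarrow> 'r quat \<Rightarrow> 'r quat" where
  "odd_superder b r s x = Quat (b * (s * qj x - r * qk x)) 0 (r * qi x) (s * qi x)"

lemma module_hom_odd_superder: "module_hom qscale qscale (odd_superder b r s)"
  unfolding module_hom_def module_hom_axioms_def
  by (simp add: module_qscale odd_superder_def quat_defs algebra_simps)

lemma qpart_0_iff: "x \<in> qpart 0 \<longleftrightarrow> qj x = 0 \<and> qk x = 0"
  by (cases x) (auto simp: qpart_def quat_defs)

lemma qpart_1_iff: "x \<in> qpart 1 \<longleftrightarrow> qre x = 0 \<and> qi x = 0"
  by (cases x) (auto simp: qpart_def quat_defs)

lemma superderivation_odd_superder: "superderivation a b 1 (odd_superder b r s)"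
proof -
  have "odd_superder b r s ` qpart \<beta> \<subseteq> qpart (1 + \<beta>)" for \<beta>
    by (cases \<beta>) (auto simp: qpart_0_iff qpart_1_iff odd_superder_def)
  moreover have "odd_superder b r s (qmult a b x y) =
      qmult a b (odd_superder b r s x) y
        + qscale ((- 1) ^ of_bit (1 * \<xi>)) (qmult a b x (odd_superder b r s y))"
    if "x \<in> qpart \<xi>" "y \<in> qpart 0 \<union> qpart 1" for x y \<xi>
    using that
    by (cases \<xi>)
      (auto simp: qpart_0_iff qpart_1_iff odd_superder_def quat_defs algebra_simps)
  ultimately show ?thesis
    by (auto simp: superderivation_def module_hom_odd_superder)
qed

lemma module_hom_quat_expansion:
  assumes "module_hom qscale qscale D"
  shows "D x = qscale (qre x) (D quat_1) + qscale (qi x) (D quat_i)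
    + qscale (qj x) (D quat_j) + qscale (qk x) (D quat_k)"
proof -
  have "D x = D (qscale (qre x) quat_1 + qscale (qi x) quat_i
      + qscale (qj x) quat_j + qscale (qk x) quat_k)"
    by (simp flip: quat_basis_expansion)
  then show ?thesis
    by (simp add: module_hom.add[OF assms] module_hom.scale[OF assms])
qed

text \<open>Multiplying by the inverses of 2 and \<open>a\<close> recovers \<open>u\<close>. The
  rules for j^2 and k^2 produce equations of this doubled shape.\<close>

lemma double_unit_mult_eq_0D:
  fixes a u :: "'r::comm_ring_1"
  assumes "(2::'r) dvd 1" "a dvd 1" "a * u + a * u = 0"
  shows "u = 0"
proof -
  from assms(1,2) obtain h c where h: "(1::'r) = 2 * h" and c: "1 = a * c"
    by (auto elim!: dvdE)
  have "u = (2 * h) * (a * c) * u"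
    by (simp flip: h c)
  also have "\<dots> = h * c * (a * u + a * u)"
    by (simp add: algebra_simps)
  finally show ?thesis
    using assms(3) by simp
qed

lemma superderivation_1_cases:
  fixes a b :: "'r::comm_ring_1"
  assumes two: "(2::'r) dvd 1" and a: "a dvd 1" and D: "superderivation a b 1 D"
  obtains r s where "D = odd_superder b r s"
proof -
  have hom: "module_hom qscale qscale D"
    using D by (simp add: superderivation_def)
  have gr: "D x \<in> qpart (1 + \<beta>)" if "x \<in> qpart \<beta>" for x \<beta>
    using D that unfolding superderivation_def by blast
  have even: "D (qmult a b x y) = qmult a b (D x) y + qmult a b x (D y)"
    if "x \<in> qpart 0" "y \<in> qpart 0 \<union> qpart 1" for x y
    using D that unfolding superderivation_def
    by (fastforce dest!: spec[of _ "0::bit"] simp: qscale_def)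
  have odd: "D (qmult a b x y) = qmult a b (D x) y - qmult a b x (D y)"
    if "x \<in> qpart 1" "y \<in> qpart 0 \<union> qpart 1" for x y
    using D that unfolding superderivation_def
    by (fastforce dest!: spec[of _ "1::bit"] simp: quat_defs)
  have basis: "quat_1 \<in> qpart 0" "quat_i \<in> qpart 0" "quat_j \<in> qpart 1" "quat_k \<in> qpart 1"
    by (auto simp: qpart_0_iff qpart_1_iff quat_defs)
  \<comment> \<open>Since 1 is even, 1 * 1 = 1 gives D(1) = D(1) + D(1).\<close>
  have one: "D quat_1 = 0"
    using even[of quat_1 quat_1] basis by (simp add: qmult_unit)
  obtain r s where i: "D quat_i = Quat 0 0 r s"
    using gr[OF basis(2)] by (cases "D quat_i") (auto simp: qpart_1_iff)
  obtain p q where j: "D quat_j = Quat p q 0 0"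
    using gr[OF basis(3)] by (cases "D quat_j") (auto simp: qpart_0_iff)
  \<comment> \<open>As j is odd, D(j^2) = D(j) j - j D(j) = 2 q k, while j^2 is a multiple of
    1.\<close>
  have "D (qmult a b quat_j quat_j) = 0"
    by (simp add: qmult_table module_hom.scale[OF hom] one) (simp add: quat_defs)
  with odd[of quat_j quat_j] have "q + q = 0"
    by (simp add: basis j) (simp add: quat_defs)
  then have q: "q = 0"
    using double_unit_mult_eq_0D[of 1 q] two by simp
  \<comment> \<open>From k = i j with i even: D(k) = (r j + s k) j + i p.\<close>
  have k: "D quat_k = Quat (- (b * r)) (p - b * s) 0 0"
    using even[of quat_i quat_j] by (simp add: basis i j q qmult_table) (simp add: quat_defs)
  \<comment> \<open>Here D(k) k - k D(k) = -2 a (p - b s) j, and cancelling 2 a ties D(j) to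
    D(i).\<close>
  have "D (qmult a b quat_k quat_k) = 0"
    by (simp add: qmult_table module_hom.scale[OF hom] one) (simp add: quat_defs)
  with odd[of quat_k quat_k] have "a * (p - b * s) + a * (p - b * s) = 0"
    by (simp add: basis k) (simp add: quat_defs algebra_simps)
  then have p: "p = b * s"
    using double_unit_mult_eq_0D[OF two a, of "p - b * s"] by simp
  have "D x = odd_superder b r s x" for x
    unfolding module_hom_quat_expansion[OF hom, of x] one i j k p q
    by (simp add: odd_superder_def quat_defs algebra_simps)
  then show thesis
    using that by blast
qed

theorem theorem3p2:
  fixes a b :: "'r::comm_ring_1"
    and \<Delta> :: "'r quat \<Rightarrow> 'r quat"
  assumes "(2::'r) dvd 1"
    and "a dvd 1" and "b dvd 1"
    and "local_superderivation a b 1 \<Delta>"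
  shows "superderivation a b 1 \<Delta>"
proof -
  have hom: "module_hom qscale qscale \<Delta>"
    using assms(4) by (simp add: local_superderivation_def)
  have loc: "\<exists>r s. \<Delta> x = odd_superder b r s x" for x
    using assms(4) superderivation_1_cases[OF assms(1,2)]
    unfolding local_superderivation_def by metis
  obtain r s where i: "\<Delta> quat_i = Quat 0 0 r s"
    using loc[of quat_i] by (auto simp: odd_superder_def quat_defs)
  obtain s' where j: "\<Delta> quat_j = Quat (b * s') 0 0 0"
    using loc[of quat_j] by (auto simp: odd_superder_def quat_defs)
  obtain r' where k: "\<Delta> quat_k = Quat (- (b * r')) 0 0 0"
    using loc[of quat_k] by (auto simp: odd_superder_def quat_defs)
  have one: "\<Delta> quat_1 = 0"
    using loc[of quat_1] by (auto simp: odd_superder_def quat_defs)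
  \<comment> \<open>The k-coordinate at i + j shows that the superderivation chosen there has second
    parameter \<open>s\<close>; its coordinate at 1 is then both \<open>b * s\<close> and
    \<open>b * s'\<close>. At i + k the j-coordinate fixes the first parameter likewise.\<close>
  have js: "b * s' = b * s"
    using loc[of "quat_i + quat_j"] unfolding module_hom.add[OF hom] i j
    by (auto simp: odd_superder_def quat_defs)
  have kr: "b * r' = b * r"
    using loc[of "quat_i + quat_k"] unfolding module_hom.add[OF hom] i k
    by (auto simp: odd_superder_def quat_defs)
  have "\<Delta> x = odd_superder b r s x" for x
    unfolding module_hom_quat_expansion[OF hom, of x] one i j k js kr
    by (simp add: odd_superder_def quat_defs algebra_simps)
  then have "\<Delta> = odd_superder b r s"
    by blast
  then show ?thesis
    by (simp add: superderivation_odd_superder)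
qed

end
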